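(* Let $N$ be a positive integer and $\omega=e^{2\pi i/N}$. Let $\xi\in\mathbb{C}$ be either a transcendental number, or an algebraic number whose degree over $\mathbb{Q}(\omega)$ is at least $N(N-1)^2+1$. Then the vector $$(1,\xi,\xi^4,\xi^9,\dots,\xi^{(N-1)^2})\in\mathbb{C}^N$$ generates a Gabor frame in general linear position.
   Context: Define the linear operators $T,M:\mathbb{C}^N\to\mathbb{C}^N$ by $$T(x_0,x_1,\dots,x_{N-1})=(x_{N-1},x_0,\dots,x_{N-2}),\qquad M(x_0,x_1,\dots,x_{N-1})=(x_0,\omega x_1,\dots,\omega^{N-1}x_{N-1}),$$ and for $(\kappa,\lambda)\in(\mathbb{Z}/N\mathbb{Z})^2$ put $\pi(\kappa,\lambda)=M^{\lambda}T^{\kappa}$. A vector $\varphi\in\mathbb{C}^N$ generates a Gabor frame in general linear position if for every $\Lambda\subseteq(\mathbb{Z}/N\mathbb{Z})^2$ with $|\Lambda|=N$ the family $(\pi(\kappa,\lambda)\varphi)_{(\kappa,\lambda)\in\Lambda}$ is a basis of $\mathbb{C}^N$. The $n$-th coordinate ($0\le n\le N-1$) of the vector in the claim is $\xi^{n^2}$. *)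

theory Defs
  imports
    "Jordan_Normal_Form.VS_Connect"
    "HOL-Algebra.Finite_Extensions"
    "HOL-Algebra.Generated_Fields"
    Complex_Main
begin

definition root_of_unity :: "nat \<Rightarrow> complex" where
  "root_of_unity N = exp (2 * of_real pi * \<i> / of_nat N)"

definition translation :: "nat \<Rightarrow> complex vec \<Rightarrow> complex vec" where
  "translation N x = vec N (\<lambda>n. if n = 0 then x $ (N - 1) else x $ (n - 1))"

definition modulation :: "nat \<Rightarrow> complex vec \<Rightarrow> complex vec" where
  "modulation N x = vec N (\<lambda>n. root_of_unity N ^ n * x $ n)"

definition time_freq_shift :: "nat \<Rightarrow> nat \<times> nat \<Rightarrow> complex vec \<Rightarrow> complex vec" where
  "time_freq_shift N = (\<lambda>(k, l). (modulation N ^^ l) \<circ> (translation N ^^ k))"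

text \<open>
  The linear-algebra library speaks of bases as sets; a basis that is an indexed family
  additionally has no repetitions.
\<close>

definition basis_family :: "nat \<Rightarrow> ('i \<Rightarrow> complex vec) \<Rightarrow> 'i set \<Rightarrow> bool" where
  "basis_family N v I \<longleftrightarrow>
     inj_on v I \<and> vectorspace.basis class_ring (module_vec TYPE(complex) N) (v ` I)"

text \<open>
  Elements of \<open>\<int>/N\<int>\<close> are represented by \<open>0, \<dots>, N - 1\<close>. The choice of representatives does
  not matter, since both operators have \<open>N\<close>-th power the identity on \<open>\<complex>\<^sup>N\<close>
  (lemmas \<open>translation_pow_N\<close> and \<open>modulation_pow_N\<close> below).
\<close>

definition gabor_frame_general_linear_position :: "nat \<Rightarrow> complex vec \<Rightarrow> bool" where
  "gabor_frame_general_linear_position N \<phi> \<longleftrightarrow>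
     (\<forall>\<Lambda> \<subseteq> {0..<N} \<times> {0..<N}. card \<Lambda> = N \<longrightarrow>
        basis_family N (\<lambda>p. time_freq_shift N p \<phi>) \<Lambda>)"

definition cyclotomic_subfield :: "nat \<Rightarrow> complex set" where
  "cyclotomic_subfield N = generate_field class_ring {root_of_unity N}"

text \<open>
  The degree of the minimal polynomial of \<open>x\<close> over the subfield \<open>K\<close>; meaningful only if \<open>x\<close> is
  algebraic over \<open>K\<close>.
\<close>

definition degree_over :: "complex set \<Rightarrow> complex \<Rightarrow> nat" where
  "degree_over K x = Polynomials.degree (ring.Irr class_ring K x)"

lemma translation_pow:
  assumes "x \<in> carrier_vec N" "k \<le> N"
  shows "(translation N ^^ k) x = vec N (\<lambda>n. if n < k then x $ (n + N - k) else x $ (n - k))"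
  using assms(2)
proof (induction k)
  case 0
  then show ?case using assms(1) by (intro eq_vecI) auto
next
  case (Suc k)
  then show ?case
    by (auto simp: translation_def intro!: eq_vecI arg_cong[where f = "\<lambda>i. x $ i"])
qed

lemma translation_pow_N:
  assumes "x \<in> carrier_vec N"
  shows "(translation N ^^ N) x = x"
  using assms by (subst translation_pow) (auto intro!: eq_vecI)

lemma modulation_pow:
  assumes "x \<in> carrier_vec N"
  shows "(modulation N ^^ k) x = vec N (\<lambda>n. root_of_unity N ^ (n * k) * x $ n)"
proof (induction k)
  case 0
  then show ?case using assms by (intro eq_vecI) auto
next
  case (Suc k)
  then show ?case by (auto simp: modulation_def power_add intro!: eq_vecI)
qed

lemma modulation_pow_N:
  assumes "x \<in> carrier_vec N"
  shows "(modulation N ^^ N) x = x"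
proof -
  have "root_of_unity N ^ N = 1" if "N > 0"
    using that by (simp add: root_of_unity_def flip: exp_of_nat_mult)
  then have "root_of_unity N ^ (n * N) = 1" if "n < N" for n
    using that by (metis gr_implies_not0 mult.commute not_gr_zero power_mult power_one)
  with assms show ?thesis by (auto simp: modulation_pow intro!: eq_vecI)
qed

end

theory Submission
  imports Defs
begin

text \<open>
  Fix \<open>N\<close> points \<open>(k, l)\<close> of the time-frequency plane. The shifts of the
  vector with entries \<open>\<xi>\<^bsup>n\<^sup>2\<^esup>\<close> are the columns of a square
  matrix; in row \<open>n\<close>, the column of \<open>(k, l)\<close> has the entry
  \<open>\<omega>\<^bsup>ln\<^esup> \<xi>\<^bsup>d\<^sup>2\<^esup>\<close>, where \<open>d = (n - k)
  mod N\<close> is the length of the arc that leads from \<open>k\<close> to \<open>n\<close> around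
  the cycle \<open>\<int>/N\<int>\<close>. By Leibniz's formula the determinant is the value at
  \<open>\<xi>\<close> of a polynomial \<open>P\<close> with coefficients in
  \<open>\<rat>(\<omega>)\<close>, and \<open>P\<close> has degree at most \<open>N (N -
  1)\<^sup>2\<close>, as each of the \<open>N\<close> arcs has length at most \<open>N - 1\<close>.
  Under either hypothesis on \<open>\<xi>\<close> no nonzero polynomial of this kind vanishes at
  \<open>\<xi>\<close> (\<open>poly_nonzero_if_degree_small\<close>), so it is enough that \<open>P
  \<noteq> 0\<close>.

  For this, one looks at the lowest power of the variable in \<open>P\<close>. A permutation
  \<open>p\<close> assigns to every row \<open>n\<close> a time shift, and its term has as exponent
  the sum of the squared lengths of the \<open>N\<close> arcs. Minimizing this sum is a transport
  problem on the cycle, with each row served by one time shift. By the cycle lemma of ballot theory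
  (\<open>cycle_lemma\<close>), the cycle can be cut at a place \<open>r\<close> such that the time
  shifts, counted from \<open>r\<close> and listed in increasing order as \<open>\<sigma> 0 \<le>
  \<sigma> 1 \<le> \<dots>\<close>, satisfy \<open>\<sigma> n \<le> n\<close>. Serving row
  \<open>n\<close> (also counted from \<open>r\<close>) by \<open>\<sigma> n\<close> then uses no
  arc across the cut, and it is the unique optimal assignment (\<open>cyclic_cost\<close>). Indeed,
  replace the length of every arc across the cut by \<open>0\<close>. This does not increase any
  cost, and the new cost of \<open>k\<close> at \<open>n\<close> is \<open>(max 0 (n -
  k))\<^sup>2\<close>, a convex function of \<open>n - k\<close>; for such costs the monotone
  assignment is optimal by the rearrangement inequality.

  Hence the permutations with the least exponent are those that preserve the blocks of equal
  \<open>\<sigma>\<close>, and the lowest coefficient of \<open>P\<close> is the determinant of a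
  block diagonal matrix. The rows \<open>n\<close> of a block are consecutive, and its columns
  \<open>(\<omega>\<^sup>l)\<^sup>n\<close> have pairwise different nodes
  \<open>\<omega>\<^sup>l\<close>. So each block is a Vandermonde matrix up to nonzero column
  factors, and the coefficient is not zero (\<open>det_block_vandermonde\<close>).
\<close>

section \<open>Polynomials over the cyclotomic field\<close>

text \<open>
  A constant of its own, because the record \<^term>\<open>class_ring\<close> is already an instance
  of the locale of rings, with its operations rewritten to those of the type. Interpreting a locale
  for it again gives neither the notions of field extensions nor the operations of the record.
\<close>

definition complex_field :: "complex ring" where
  "complex_field = class_ring"

lemma complex_field_simps [simp]:
  "carrier complex_field = UNIV" "monoid.mult complex_field = (*)" "one complex_field = 1"
  "zero complex_field = 0" "add complex_field = (+)"
  by (simp_all add: complex_field_def)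

lemma field_complex_field: "field complex_field"
  unfolding complex_field_def by (rule class_field)

interpretation CC: domain complex_field
  using field_complex_field by (rule field.axioms(1))

lemma complex_field_nat_pow: "x [^]\<^bsub>complex_field\<^esub> (n :: nat) = x ^ n"
  by (induction n) (simp_all add: mult.commute)

text \<open>
  The lists that represent polynomials over a ring start with the leading coefficient, whereas
  \<^const>\<open>Poly\<close> and \<^const>\<open>coeffs\<close> start with the constant term;
  hence the reversals here and below.
\<close>

lemma eval_complex_field: "CC.eval cs x = poly (Poly (rev cs)) x"
proof (induction cs)
  case (Cons c cs)
  then show ?case
    by (simp add: complex_field_nat_pow Poly_append poly_monom)
qed simp

lemma coeffs_carrier:
  assumes "\<And>i. Polynomial.coeff P i \<in> K"
  shows "rev (coeffs P) \<in> carrier (K[X]\<^bsub>complex_field\<^esub>)"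
proof (cases "P = 0")
  case False
  then have "hd (rev (coeffs P)) \<noteq> 0"
    by (simp add: hd_rev last_coeffs_eq_coeff_degree)
  then show ?thesis
    using assms False
    by (auto simp: univ_poly_carrier[symmetric] polynomial_def coeffs_def)
qed (simp add: univ_poly_carrier[symmetric] polynomial_def)

lemma algebraic_over_if_root:
  assumes "\<And>i. Polynomial.coeff P i \<in> K" "P \<noteq> 0" "poly P x = 0"
  shows "(CC.algebraic over K) x"
  using CC.algebraicI[OF coeffs_carrier[OF assms(1)]] assms(2,3)
  by (simp add: eval_complex_field)

text \<open>
  The minimal polynomial divides every polynomial over \<open>K\<close> that has \<open>x\<close> as
  a root.
\<close>

lemma degree_over_le_degree:
  assumes "subfield K complex_field"
    and "\<And>i. Polynomial.coeff P i \<in> K" "P \<noteq> 0" "poly P x = 0"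
  shows "degree_over K x \<le> Polynomial.degree P"
proof -
  have alg: "(CC.algebraic over K) x"
    using assms(2-4) by (rule algebraic_over_if_root)
  have x: "x \<in> carrier complex_field"
    by simp
  have "Polynomials.degree (CC.Irr K x) \<le> Polynomials.degree (rev (coeffs P))"
  proof (rule CC.pdivides_imp_degree_le[OF _ _ _ _ CC.Irr_minimal[OF assms(1) x alg]])
    show "subring K complex_field"
      using assms(1) by (rule subfieldE(1))
    show "CC.Irr K x \<in> carrier (K[X]\<^bsub>complex_field\<^esub>)"
      by (rule CC.IrrE(1)[OF assms(1) x alg])
    show "CC.eval (rev (coeffs P)) x = \<zero>\<^bsub>complex_field\<^esub>"
      using assms(4) by (simp add: eval_complex_field)
  qed (use assms coeffs_carrier in auto)
  also have "\<dots> = Polynomial.degree P"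
    by (simp add: degree_eq_length_coeffs)
  finally show ?thesis
    by (simp add: degree_over_def complex_field_def)
qed

lemma subfield_Rats: "subfield \<rat> complex_field"
proof (rule field.subfieldI'[OF field_complex_field])
  show "subring \<rat> complex_field"
  proof (rule CC.subringI)
    fix h :: complex assume "h \<in> \<rat>"
    moreover have "\<ominus>\<^bsub>complex_field\<^esub> h = - h"
      by (rule CC.minus_equality) auto
    ultimately show "\<ominus>\<^bsub>complex_field\<^esub> h \<in> \<rat>" by simp
  qed auto
next
  fix k :: complex assume k: "k \<in> \<rat> - {\<zero>\<^bsub>complex_field\<^esub>}"
  then have "inv\<^bsub>complex_field\<^esub> k = inverse k"
    by (intro CC.comm_inv_char) auto
  then show "inv\<^bsub>complex_field\<^esub> k \<in> \<rat>" using k by simp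
qed

lemma algebraic_if_algebraic_over_Rats:
  assumes "(CC.algebraic over \<rat>) x"
  shows "algebraic x"
proof -
  obtain cs where cs: "cs \<in> carrier (\<rat>[X]\<^bsub>complex_field\<^esub>)" "cs \<noteq> []" "CC.eval cs x = 0"
    using CC.algebraicE[OF subfieldE(1)[OF subfield_Rats] _ assms] by auto
  show ?thesis
  proof (rule algebraicI')
    show "Polynomial.coeff (Poly (rev cs)) i \<in> \<rat>" for i
      using cs(1) nth_mem[of i "rev cs"]
      by (auto simp: univ_poly_carrier[symmetric] polynomial_def nth_default_def)
    have "Polynomial.coeff (Poly (rev cs)) (length cs - 1) = hd cs"
      using cs(2) by (simp add: nth_default_def hd_conv_nth rev_nth)
    moreover have "hd cs \<noteq> 0"
      using cs(1,2) by (auto simp: univ_poly_carrier[symmetric] polynomial_def)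
    ultimately show "Poly (rev cs) \<noteq> 0" by force
    show "poly (Poly (rev cs)) x = 0"
      using cs(3) by (simp add: eval_complex_field)
  qed
qed

lemma root_of_unity_pow_N: "N > 0 \<Longrightarrow> root_of_unity N ^ N = 1"
  by (simp add: root_of_unity_def flip: exp_of_nat_mult)

lemma algebraic_root_of_unity:
  assumes "N > 0"
  shows "(CC.algebraic over \<rat>) (root_of_unity N)"
proof (rule algebraic_over_if_root[where P = "Polynomial.monom 1 N - 1"])
  show "Polynomial.coeff (Polynomial.monom 1 N - 1 :: complex poly) i \<in> \<rat>" for i
    by simp
  show "Polynomial.monom 1 N - 1 \<noteq> (0 :: complex poly)"
    using assms by (metis (no_types) degree_1 degree_monom_eq eq_iff_diff_eq_0 less_irrefl zero_neq_one)
qed (simp add: root_of_unity_pow_N[OF assms] poly_monom)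

lemma subfield_cyclotomic: "subfield (cyclotomic_subfield N) complex_field"
  unfolding cyclotomic_subfield_def complex_field_def[symmetric]
  by (intro field.generate_field_is_subfield[OF field_complex_field]) simp

text \<open>
  Transitivity of algebraic extensions, by the tower law: \<open>\<rat>(\<omega>)\<close> has finite
  dimension over \<open>\<rat>\<close>, and \<open>\<rat>(\<omega>, x)\<close> has finite dimension
  over \<open>\<rat>(\<omega>)\<close>.
\<close>

lemma algebraic_if_algebraic_over_cyclotomic:
  assumes "N > 0" "(CC.algebraic over (cyclotomic_subfield N)) x"
  shows "algebraic x"
proof -
  define L where "L = CC.simple_extension \<rat> (root_of_unity N)"
  have carr: "y \<in> carrier complex_field" for y :: complex
    by simp
  have L: "subfield L complex_field"
    unfolding L_def using CC.simple_extension_is_subfield[OF subfield_Rats carr]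
      algebraic_root_of_unity[OF assms(1)] by blast
  have "cyclotomic_subfield N \<subseteq> L"
    unfolding cyclotomic_subfield_def complex_field_def[symmetric]
    using CC.simple_extension_mem[OF subfieldE(1)[OF subfield_Rats] carr]
    by (intro field.generate_field_min_subfield1[OF field_complex_field] L) (auto simp: L_def carr)
  then have alg: "(CC.algebraic over L) x"
    using assms(2) CC.algebraic_mono by blast
  have "CC.finite_dimension \<rat> L"
    unfolding L_def
    using CC.finite_dimension_simple_extension[OF subfield_Rats carr]
      algebraic_root_of_unity[OF assms(1)] by blast
  moreover have "CC.finite_dimension L (CC.simple_extension L x)"
    using CC.finite_dimension_simple_extension[OF L carr] alg by blast
  ultimately have "CC.finite_dimension \<rat> (CC.simple_extension L x)"
    by (rule CC.telescopic_base_dim(1)[OF subfield_Rats L])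
  then have "(CC.algebraic over \<rat>) x"
    using CC.finite_dimension_imp_algebraic[OF subfield_Rats]
      CC.simple_extension_is_subring[OF subfieldE(1)[OF L] carr]
      CC.simple_extension_mem[OF subfieldE(1)[OF L] carr] by blast
  then show ?thesis
    by (rule algebraic_if_algebraic_over_Rats)
qed

text \<open>
  Both alternatives of the hypothesis on the number are used only through this criterion. With
  \<open>d = N (N - 1)\<^sup>2\<close> it applies to the determinants of the shifts.
\<close>

lemma poly_nonzero_if_degree_small:
  assumes "N > 0"
    and "\<not> algebraic x \<or> d < degree_over (cyclotomic_subfield N) x"
    and "\<And>i. Polynomial.coeff P i \<in> cyclotomic_subfield N" "P \<noteq> 0" "Polynomial.degree P \<le> d"
  shows "poly P x \<noteq> 0"
proof
  assume *: "poly P x = 0"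
  show False using assms(2)
  proof
    assume "\<not> algebraic x"
    then show False
      using algebraic_if_algebraic_over_cyclotomic[OF assms(1)]
        algebraic_over_if_root[OF assms(3,4) *] by blast
  next
    assume "d < degree_over (cyclotomic_subfield N) x"
    then show False
      using degree_over_le_degree[OF subfield_cyclotomic assms(3,4) *] assms(5) by linarith
  qed
qed

lemma cyclotomic_closed:
  shows "1 \<in> cyclotomic_subfield N"
    and "0 \<in> cyclotomic_subfield N"
    and "root_of_unity N \<in> cyclotomic_subfield N"
    and "a \<in> cyclotomic_subfield N \<Longrightarrow> - a \<in> cyclotomic_subfield N"
    and "a \<in> cyclotomic_subfield N \<Longrightarrow> b \<in> cyclotomic_subfield N \<Longrightarrow> a + b \<in> cyclotomic_subfield N"
    and "a \<in> cyclotomic_subfield N \<Longrightarrow> b \<in> cyclotomic_subfield N \<Longrightarrow> a * b \<in> cyclotomic_subfield N"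
    and "a \<in> cyclotomic_subfield N \<Longrightarrow> a ^ m \<in> cyclotomic_subfield N"
proof -
  note sub = subfieldE(1)[OF subfield_cyclotomic[of N]]
  show one: "1 \<in> cyclotomic_subfield N" and "0 \<in> cyclotomic_subfield N"
    using subringE(2,3)[OF sub] by simp_all
  show "root_of_unity N \<in> cyclotomic_subfield N"
    unfolding cyclotomic_subfield_def by (rule generate_field.incl) simp
  have "\<ominus>\<^bsub>complex_field\<^esub> a = - a"
    by (rule CC.minus_equality) auto
  then show "a \<in> cyclotomic_subfield N \<Longrightarrow> - a \<in> cyclotomic_subfield N"
    using subringE(5)[OF sub, of a] by simp
  show "a \<in> cyclotomic_subfield N \<Longrightarrow> b \<in> cyclotomic_subfield N \<Longrightarrow> a + b \<in> cyclotomic_subfield N"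
    using subringE(7)[OF sub, of a b] by simp
  have mult: "x \<in> cyclotomic_subfield N \<Longrightarrow> y \<in> cyclotomic_subfield N \<Longrightarrow> x * y \<in> cyclotomic_subfield N" for x y
    using subringE(6)[OF sub, of x y] by simp
  then show "a \<in> cyclotomic_subfield N \<Longrightarrow> b \<in> cyclotomic_subfield N \<Longrightarrow> a * b \<in> cyclotomic_subfield N" .
  show "a \<in> cyclotomic_subfield N \<Longrightarrow> a ^ m \<in> cyclotomic_subfield N"
    by (induction m) (simp_all add: one mult)
qed

section \<open>Optimal assignments on a cycle\<close>

text \<open>
  Subtraction of natural numbers is truncated, so \<open>(n - k)\<^sup>2\<close> is the convex
  function \<open>x \<mapsto> (max 0 x)\<^sup>2\<close> of the integer difference. Convexity is what
  makes it favourable to serve the earlier of two places by the earlier of two sources. The function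
  is constant where it truncates, so strictness is claimed only if none of the four differences is
  truncated.
\<close>

lemma truncated_square_exchange:
  fixes a b k l :: nat
  assumes "a \<le> b" "k \<le> l"
  shows "(a - k)\<^sup>2 + (b - l)\<^sup>2 \<le> (a - l)\<^sup>2 + (b - k)\<^sup>2"
    and "a < b \<Longrightarrow> k < l \<Longrightarrow> l \<le> a \<Longrightarrow> (a - k)\<^sup>2 + (b - l)\<^sup>2 < (a - l)\<^sup>2 + (b - k)\<^sup>2"
proof -
  have *: "(a - k)\<^sup>2 + (b - l)\<^sup>2 + 2 * ((b - a) * (l - k)) = (a - l)\<^sup>2 + (b - k)\<^sup>2" if la: "l \<le> a"
  proof -
    obtain x where a: "a = l + x" using le_Suc_ex[OF la] by blast
    obtain y where b: "b = a + y" using le_Suc_ex[OF assms(1)] by blast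
    obtain z where l: "l = k + z" using le_Suc_ex[OF assms(2)] by blast
    have "a - k = z + x" "b - l = x + y" "b - a = y" "l - k = z" "a - l = x" "b - k = z + x + y"
      using a b l by auto
    then show ?thesis by (simp add: power2_eq_square algebra_simps)
  qed
  then show "a < b \<Longrightarrow> k < l \<Longrightarrow> l \<le> a \<Longrightarrow> (a - k)\<^sup>2 + (b - l)\<^sup>2 < (a - l)\<^sup>2 + (b - k)\<^sup>2"
  proof -
    assume "a < b" "k < l" "l \<le> a"
    then have "0 < 2 * ((b - a) * (l - k))" by simp
    then show ?thesis using *[OF \<open>l \<le> a\<close>] by linarith
  qed
  show "(a - k)\<^sup>2 + (b - l)\<^sup>2 \<le> (a - l)\<^sup>2 + (b - k)\<^sup>2"
  proof (cases "l \<le> a")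
    case True
    with * show ?thesis by linarith
  next
    case False
    have "(a - k)\<^sup>2 + (b - l)\<^sup>2 \<le> ((a - k) + (b - l))\<^sup>2"
      by (simp add: power2_sum)
    also have "\<dots> \<le> (b - k)\<^sup>2"
      using False assms by (intro power_mono) auto
    finally show ?thesis using False by simp
  qed
qed

lemma permutes_transpose_comp:
  assumes "p permutes A" "a \<in> A" "b \<in> A"
  shows "(Transposition.transpose a b \<circ> p) permutes A" "(p \<circ> Transposition.transpose a b) permutes A"
  using assms by (auto intro!: permutes_compose permutes_swap_id)

lemma sum_two_changes:
  fixes f g :: "'i \<Rightarrow> nat"
  assumes "finite A" "a \<in> A" "b \<in> A" "a \<noteq> b" "\<And>x. x \<in> A \<Longrightarrow> x \<noteq> a \<Longrightarrow> x \<noteq> b \<Longrightarrow> f x = g x"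
  shows "\<exists>c. sum f A = f a + f b + c \<and> sum g A = g a + g b + c"
proof (intro exI conjI)
  have A: "A = insert a (insert b (A - {a, b}))" using assms by auto
  show "sum f A = f a + f b + sum f (A - {a, b})"
    by (subst A) (use assms in \<open>simp add: add.assoc\<close>)
  have "sum g A = g a + g b + sum g (A - {a, b})"
    by (subst A) (use assms in \<open>simp add: add.assoc\<close>)
  also have "sum g (A - {a, b}) = sum f (A - {a, b})"
    using assms by (intro sum.cong) auto
  finally show "sum g A = g a + g b + sum f (A - {a, b})" .
qed

text \<open>
  The rearrangement inequality, for costs that satisfy the exchange inequality instead of products.
  In the induction step one exchange makes the permutation fix the last place, which does not
  increase the cost.
\<close>

lemma rearrangement:
  fixes f :: "nat \<Rightarrow> nat \<Rightarrow> nat"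
  assumes exch: "\<And>a b k l. a \<le> b \<Longrightarrow> k \<le> l \<Longrightarrow> f a k + f b l \<le> f a l + f b k"
  shows "mono_on {0..<N} \<sigma> \<Longrightarrow> p permutes {0..<N} \<Longrightarrow>
    (\<Sum>n = 0..<N. f n (\<sigma> n)) \<le> (\<Sum>n = 0..<N. f n (\<sigma> (p n)))"
proof (induction N arbitrary: p)
  case (Suc N)
  have mono: "mono_on {0..<N} \<sigma>"
    using Suc.prems(1) by (rule mono_on_subset) auto
  obtain a where pa: "p a = N"
    using permutes_surj[OF Suc.prems(2)] by (metis surjD)
  have a: "a \<in> {0..<Suc N}"
    using permutes_in_image[OF Suc.prems(2), of a] pa by auto
  define b where "b = p N"
  have b: "b \<in> {0..<Suc N}"
    using permutes_in_image[OF Suc.prems(2), of N] by (auto simp: b_def)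
  define q where "q = Transposition.transpose N b \<circ> p"
  have q_Suc: "q permutes {0..<Suc N}"
    unfolding q_def using Suc.prems(2) b by (intro permutes_transpose_comp) auto
  have "q N = N"
    by (simp add: q_def b_def)
  then have q: "q permutes {0..<N}"
    using q_Suc by (auto intro: permutes_superset simp: atLeast0_lessThan_Suc)
  have "(\<Sum>n = 0..<Suc N. f n (\<sigma> n)) \<le> (\<Sum>n = 0..<Suc N. f n (\<sigma> (q n)))"
    using Suc.IH[OF mono q] by (simp add: \<open>q N = N\<close>)
  also have "\<dots> \<le> (\<Sum>n = 0..<Suc N. f n (\<sigma> (p n)))"
  proof (cases "a = N")
    case True
    then have "q = p" using pa by (simp add: q_def b_def)
    then show ?thesis by simp
  next
    case False
    have "q x = p x" if "x \<noteq> a" "x \<noteq> N" for x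
    proof -
      have "p x \<noteq> p a" "p x \<noteq> p N"
        using that permutes_inj[OF Suc.prems(2)] by (auto dest: injD)
      then show ?thesis by (simp add: q_def b_def pa)
    qed
    then obtain c where c: "(\<Sum>n = 0..<Suc N. f n (\<sigma> (q n))) = f a (\<sigma> (q a)) + f N (\<sigma> (q N)) + c"
        "(\<Sum>n = 0..<Suc N. f n (\<sigma> (p n))) = f a (\<sigma> (p a)) + f N (\<sigma> (p N)) + c"
      using sum_two_changes[of "{0..<Suc N}" a N "\<lambda>n. f n (\<sigma> (q n))" "\<lambda>n. f n (\<sigma> (p n))"] a False
      by auto
    have "q a = b" by (simp add: q_def pa)
    moreover have "\<sigma> b \<le> \<sigma> N"
      using b by (intro mono_onD[OF Suc.prems(1)]) auto
    then have "f a (\<sigma> b) + f N (\<sigma> N) \<le> f a (\<sigma> N) + f N (\<sigma> b)"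
      using a by (intro exch) auto
    ultimately show ?thesis
      unfolding c \<open>q N = N\<close> pa b_def[symmetric] by simp
  qed
  finally show ?case .
qed simp

text \<open>
  A list has only one sorted rearrangement.
\<close>

lemma mono_rearrangement_unique:
  fixes \<sigma> :: "nat \<Rightarrow> nat"
  assumes "mono_on {0..<N} \<sigma>" "p permutes {0..<N}" "mono_on {0..<N} (\<sigma> \<circ> p)" "n < N"
  shows "\<sigma> (p n) = \<sigma> n"
proof -
  have "image_mset p (mset_set {0..<N}) = mset_set {0..<N}"
    using assms(2) by (metis image_mset_mset_set permutes_image permutes_inj_on)
  then have "mset (map (\<sigma> \<circ> p) [0..<N]) = mset (map \<sigma> [0..<N])"
    by (simp flip: multiset.map_comp mset_set_upto_eq_mset_upto)
  moreover have "sorted (map \<tau> [0..<N])" if "mono_on {0..<N} \<tau>" for \<tau> :: "nat \<Rightarrow> nat"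
    using that by (auto simp: sorted_iff_nth_mono intro: mono_onD)
  ultimately have "map (\<sigma> \<circ> p) [0..<N] = map \<sigma> [0..<N]"
    using assms(1,3) by (metis properties_for_sort)
  then show ?thesis
    using assms(4) by (simp add: map_eq_conv)
qed

text \<open>
  Truncating the arcs across the cut to length \<open>0\<close> bounds the cyclic cost from below by
  one to which the rearrangement inequality applies, and for \<open>\<sigma>\<close> itself both
  costs agree. In case of equality no arc crosses the cut, as it would lose length by the
  truncation, and \<open>\<sigma> \<circ> p\<close> has no descent, as exchanging the two values
  would strictly decrease the minimal cost.
\<close>

lemma cyclic_cost:
  fixes \<sigma> :: "nat \<Rightarrow> nat"
  assumes mono: "mono_on {0..<N} \<sigma>" and le: "\<And>n. n < N \<Longrightarrow> \<sigma> n \<le> n" and p: "p permutes {0..<N}"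
  shows "(\<Sum>n = 0..<N. ((n + N - \<sigma> (p n)) mod N)\<^sup>2) \<ge> (\<Sum>n = 0..<N. ((n + N - \<sigma> n) mod N)\<^sup>2)" (is "?A \<ge> ?B")
    and "(\<Sum>n = 0..<N. ((n + N - \<sigma> (p n)) mod N)\<^sup>2) = (\<Sum>n = 0..<N. ((n + N - \<sigma> n) mod N)\<^sup>2) \<longleftrightarrow>
      (\<forall>n < N. \<sigma> (p n) = \<sigma> n)" (is "_ \<longleftrightarrow> ?R")
proof -
  have bound: "\<sigma> (p n) < N" if "n < N" for n
    using permutes_in_image[OF p, of n] le[of "p n"] that by auto
  have dist: "(n + N - k) mod N = (if k \<le> n then n - k else n + N - k)" if "n < N" "k < N" for n k
  proof (cases "k \<le> n")
    case True
    then have "(n + N - k) mod N = (n - k) mod N"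
      by (metis Nat.add_diff_assoc2 mod_add_self2)
    with True that show ?thesis by simp
  qed (use that in simp)
  have B: "?B = (\<Sum>n = 0..<N. (n - \<sigma> n)\<^sup>2)"
  proof (rule sum.cong)
    fix n assume "n \<in> {0..<N}"
    then have "n < N" "\<sigma> n \<le> n" "\<sigma> n < N" using le[of n] by auto
    then show "((n + N - \<sigma> n) mod N)\<^sup>2 = (n - \<sigma> n)\<^sup>2" by (simp only: dist if_True)
  qed simp
  have opt: "(\<Sum>n = 0..<N. (n - \<sigma> n)\<^sup>2) \<le> (\<Sum>n = 0..<N. (n - \<sigma> (q n))\<^sup>2)" if "q permutes {0..<N}" for q
    using rearrangement[of "\<lambda>n k. (n - k)\<^sup>2", OF truncated_square_exchange(1) mono that] by simp
  have ptw: "(n - \<sigma> (p n))\<^sup>2 \<le> ((n + N - \<sigma> (p n)) mod N)\<^sup>2" if "n \<in> {0..<N}" for n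
    using that bound by (auto simp: dist)
  have le2: "(\<Sum>n = 0..<N. (n - \<sigma> (p n))\<^sup>2) \<le> ?A"
    using ptw by (rule sum_mono)
  show "?A \<ge> ?B"
    using opt[OF p] le2 B by linarith
  show "?A = ?B \<longleftrightarrow> ?R"
  proof
    assume eq: "?A = ?B"
    have min: "(\<Sum>n = 0..<N. (n - \<sigma> (p n))\<^sup>2) = (\<Sum>n = 0..<N. (n - \<sigma> n)\<^sup>2)"
      using opt[OF p] le2 B eq by linarith
    have no_wrap: "\<sigma> (p n) \<le> n" if "n < N" for n
    proof (rule ccontr)
      assume "\<not> \<sigma> (p n) \<le> n"
      then have "(n - \<sigma> (p n))\<^sup>2 < ((n + N - \<sigma> (p n)) mod N)\<^sup>2"
        using that bound[OF that] by (simp add: dist)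
      then have "(\<Sum>n = 0..<N. (n - \<sigma> (p n))\<^sup>2) < ?A"
        using that ptw by (intro sum_strict_mono_ex1) auto
      then show False using min eq B by linarith
    qed
    have "mono_on {0..<N} (\<sigma> \<circ> p)"
    proof (rule ccontr)
      assume "\<not> mono_on {0..<N} (\<sigma> \<circ> p)"
      then obtain a b where ab: "a < N" "b < N" "a \<le> b" "\<sigma> (p b) < \<sigma> (p a)"
        by (auto simp: monotone_on_def not_le)
      then have "a < b" by (metis le_eq_less_or_eq less_irrefl)
      define q where "q = p \<circ> Transposition.transpose a b"
      have q: "q permutes {0..<N}"
        unfolding q_def using p ab by (intro permutes_transpose_comp) auto
      obtain c where c: "(\<Sum>n = 0..<N. (n - \<sigma> (q n))\<^sup>2) = (a - \<sigma> (q a))\<^sup>2 + (b - \<sigma> (q b))\<^sup>2 + c"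
          "(\<Sum>n = 0..<N. (n - \<sigma> (p n))\<^sup>2) = (a - \<sigma> (p a))\<^sup>2 + (b - \<sigma> (p b))\<^sup>2 + c"
        using sum_two_changes[of "{0..<N}" a b "\<lambda>n. (n - \<sigma> (q n))\<^sup>2" "\<lambda>n. (n - \<sigma> (p n))\<^sup>2"] ab \<open>a < b\<close>
        by (auto simp: q_def)
      have "(a - \<sigma> (p b))\<^sup>2 + (b - \<sigma> (p a))\<^sup>2 < (a - \<sigma> (p a))\<^sup>2 + (b - \<sigma> (p b))\<^sup>2"
        using ab \<open>a < b\<close> no_wrap by (intro truncated_square_exchange(2)) auto
      then have "(\<Sum>n = 0..<N. (n - \<sigma> (q n))\<^sup>2) < (\<Sum>n = 0..<N. (n - \<sigma> n)\<^sup>2)"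
        unfolding min[symmetric] c by (simp add: q_def)
      then show False
        using opt[OF q] by linarith
    qed
    then show ?R
      using mono_rearrangement_unique[OF mono p] by blast
  qed simp
qed

text \<open>
  Let \<open>S t\<close> be the number of points with \<open>f p < t\<close>, minus
  \<open>t\<close>. As \<open>S N = S 0\<close>, it extends to a periodic function, and cutting the
  cycle where \<open>S\<close> is minimal makes all its increments from there on nonnegative.
  Applied to the time shifts of \<open>N\<close> points, this is the cut that no arc of the monotone
  assignment crosses.
\<close>

lemma cycle_lemma:
  fixes f :: "'i \<Rightarrow> nat"
  assumes "card I = N" "N > 0" "\<And>p. p \<in> I \<Longrightarrow> f p < N"
  obtains r where "r < N" "\<And>j. j \<le> N \<Longrightarrow> j \<le> card {p \<in> I. (f p + N - r) mod N < j}"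
proof -
  have fin: "finite I" using assms(1,2) card.infinite by fastforce
  define c where "c t = card {p \<in> I. f p < t}" for t
  define S where "S t = int (c t) - int t" for t
  have "\<exists>r \<in> {0..<N}. \<forall>t \<in> {0..<N}. S r \<le> S t"
    using ex_is_arg_min_if_finite[of "{0..<N}" S] assms(2) by (fastforce simp: is_arg_min_linorder)
  then obtain r where r: "r < N" "\<And>t. t < N \<Longrightarrow> S r \<le> S t" by auto
  have cN: "c N = N"
  proof -
    have "{p \<in> I. f p < N} = I" using assms(3) by auto
    then show ?thesis using assms(1) by (simp add: c_def)
  qed
  have S0: "S 0 = 0" "S N = 0" using cN by (simp_all add: S_def c_def)
  then have rN: "S r \<le> S t" if "t \<le> N" for t
    using r(2)[of t] r(2)[of 0] that assms(2) by (cases "t = N") auto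
  have shift: "(k + N - r) mod N = (if r \<le> k then k - r else k + N - r)" if "k < N" for k
  proof (cases "r \<le> k")
    case True
    then have "(k + N - r) mod N = (k - r) mod N"
      by (metis Nat.add_diff_assoc2 mod_add_self2)
    with True that show ?thesis by simp
  qed (use that in simp)
  have "j \<le> card {p \<in> I. (f p + N - r) mod N < j}" if j: "j \<le> N" for j
  proof (cases "r + j \<le> N")
    case True
    have "{p \<in> I. (f p + N - r) mod N < j} = {p \<in> I. f p < r + j} - {p \<in> I. f p < r}"
    proof -
      have "(f p + N - r) mod N < j \<longleftrightarrow> r \<le> f p \<and> f p < r + j" if "p \<in> I" for p
        unfolding shift[OF assms(3)[OF that]] using assms(3)[OF that] True by auto
      then show ?thesis by auto
    qed
    moreover have "card ({p \<in> I. f p < r + j} - {p \<in> I. f p < r}) = c (r + j) - c r"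
      unfolding c_def using fin by (intro card_Diff_subset) auto
    moreover have "S r \<le> S (r + j)" using rN True by simp
    ultimately show ?thesis by (simp add: S_def)
  next
    case False
    have "(f p + N - r) mod N < j \<longleftrightarrow> r \<le> f p \<or> f p < r + j - N" if "p \<in> I" for p
      unfolding shift[OF assms(3)[OF that]] using assms(3)[OF that] False r(1) by auto
    then have "{p \<in> I. (f p + N - r) mod N < j} = (I - {p \<in> I. f p < r}) \<union> {p \<in> I. f p < r + j - N}"
      by auto
    moreover have "card \<dots> = card (I - {p \<in> I. f p < r}) + c (r + j - N)"
      unfolding c_def using fin False j by (intro card_Un_disjoint) auto
    moreover have "card (I - {p \<in> I. f p < r}) = N - c r"
      unfolding c_def assms(1)[symmetric] using fin by (intro card_Diff_subset) auto
    moreover have "c r \<le> N"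
      unfolding c_def assms(1)[symmetric] using fin by (intro card_mono) auto
    moreover have "S r \<le> S (r + j - N)" using rN j r(1) by simp
    ultimately show ?thesis using False by (simp add: S_def)
  qed
  with r(1) show ?thesis using that by blast
qed

text \<open>
  Turns the counting condition of the cycle lemma into the pointwise bound that the cost estimate
  needs: if the \<open>i\<close>-th smallest value, counted from \<open>0\<close>, exceeded
  \<open>i\<close>, then at most \<open>i\<close> values would be smaller than \<open>i + 1\<close>.
\<close>

lemma sorted_enumeration:
  fixes g :: "'i \<Rightarrow> nat"
  assumes "finite I" "card I = N" "\<And>j. j \<le> N \<Longrightarrow> j \<le> card {p \<in> I. g p < j}"
  obtains q where "bij_betw q {0..<N} I" "mono_on {0..<N} (g \<circ> q)" "\<And>i. i < N \<Longrightarrow> g (q i) \<le> i"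
proof -
  obtain xs where xs: "set xs = I" "distinct xs"
    using finite_distinct_list[OF assms(1)] by blast
  define ys where "ys = sort_key g xs"
  have ys: "set ys = I" "distinct ys" "sorted (map g ys)"
    using xs by (simp_all add: ys_def)
  have len: "length ys = N"
    using ys assms(2) distinct_card by metis
  have mono: "mono_on {0..<N} (g \<circ> (!) ys)"
    using ys(3) len by (auto simp: monotone_on_def sorted_iff_nth_mono)
  have "g (ys ! i) \<le> i" if i: "i < N" for i
  proof (rule ccontr)
    assume *: "\<not> g (ys ! i) \<le> i"
    have "{p \<in> I. g p < Suc i} \<subseteq> (!) ys ` {0..<i}"
    proof
      fix p assume "p \<in> {p \<in> I. g p < Suc i}"
      then have p: "p \<in> set ys" "g p \<le> i" using ys(1) by auto
      then obtain m where m: "m < N" "p = ys ! m" using len by (auto simp: in_set_conv_nth)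
      have "m < i"
        using mono_onD[OF mono, of i m] i m p(2) * by (fastforce simp: not_le[symmetric])
      with m show "p \<in> (!) ys ` {0..<i}" by auto
    qed
    then have "card {p \<in> I. g p < Suc i} \<le> i"
      using surj_card_le[of "{0..<i}"] by simp
    then show False using assms(3)[of "Suc i"] i by simp
  qed
  moreover have "bij_betw ((!) ys) {0..<N} I"
    using bij_betw_nth[OF ys(2), of "{0..<N}" I] ys(1) len by (simp add: atLeast0LessThan)
  ultimately show ?thesis using that mono by blast
qed

section \<open>The lowest coefficient of the determinant\<close>

text \<open>
  As \<open>\<sigma>\<close> is monotone, a block of equal \<open>\<sigma>\<close> is an interval
  of, say, \<open>L\<close> indices. The entries of a kernel vector on the block are the
  coefficients of a polynomial of degree less than \<open>L\<close>, up to a common power of the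
  variable, and the \<open>L\<close> different nodes \<open>z i\<close> of the block are roots of
  it.
\<close>

lemma block_vandermonde_kernel:
  fixes z a :: "nat \<Rightarrow> complex" and \<sigma> :: "nat \<Rightarrow> nat"
  assumes mono: "mono_on {0..<N} \<sigma>" and inj: "inj_on (\<lambda>i. (\<sigma> i, z i)) {0..<N}"
    and nz: "\<And>i. i < N \<Longrightarrow> z i \<noteq> 0"
    and ker: "\<And>i. i < N \<Longrightarrow> (\<Sum>n | n < N \<and> \<sigma> n = \<sigma> i. a n * z i ^ (n + r)) = 0"
    and n: "n < N"
  shows "a n = 0"
proof -
  define B where "B = {m. m < N \<and> \<sigma> m = \<sigma> n}"
  have fin: "finite B" and nB: "n \<in> B" using n by (auto simp: B_def)
  define s where "s = Min B"
  have s: "s \<in> B" "\<And>m. m \<in> B \<Longrightarrow> s \<le> m"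
    using fin nB by (auto simp: s_def intro: Min_in)
  have deg: "m - s < card B" if m: "m \<in> B" for m
  proof -
    have "k \<in> B" if "k \<in> {s..m}" for k
    proof -
      have "m < N" using m by (simp add: B_def)
      then have "\<sigma> s \<le> \<sigma> k" "\<sigma> k \<le> \<sigma> m"
        using that by (auto intro!: mono_onD[OF mono])
      then show ?thesis using that s(1) m by (auto simp: B_def)
    qed
    then have "card {s..m} \<le> card B" using fin by (intro card_mono) auto
    then show ?thesis using s(2)[OF m] by simp
  qed
  define P where "P = (\<Sum>m\<in>B. Polynomial.monom (a m) (m - s))"
  have root: "poly P (z i) = 0" if i: "i \<in> B" for i
  proof -
    have "0 = (\<Sum>m\<in>B. a m * z i ^ (m + r))"
      using ker[of i] i by (simp add: B_def)
    also have "\<dots> = (\<Sum>m\<in>B. z i ^ (s + r) * (a m * z i ^ (m - s)))"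
      using s(2) by (intro sum.cong refl) (simp add: mult_ac flip: power_add)
    also have "\<dots> = z i ^ (s + r) * poly P (z i)"
      by (simp add: P_def poly_sum poly_monom sum_distrib_left)
    finally show ?thesis using nz[of i] i by (simp add: B_def)
  qed
  have "P = 0"
  proof (rule ccontr)
    assume P: "P \<noteq> 0"
    have "inj_on z B"
      using inj by (auto simp: inj_on_def B_def)
    then have "card B = card (z ` B)"
      by (simp add: card_image)
    also have "\<dots> \<le> card {x. poly P x = 0}"
      using root P by (intro card_mono poly_roots_finite) auto
    also have "\<dots> \<le> Polynomial.degree P"
      using P by (rule card_poly_roots_bound)
    also have "\<dots> \<le> card B - 1"
      unfolding P_def using deg by (intro degree_sum_le fin order.trans[OF degree_monom_le]) fastforce
    also have "\<dots> < card B"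
    proof -
      have "0 < card B" using nB fin card_gt_0_iff by blast
      then show ?thesis by simp
    qed
    finally show False by simp
  qed
  then have "0 = Polynomial.coeff P (n - s)" by simp
  also have "\<dots> = (\<Sum>m\<in>B. if m = n then a m else 0)"
    unfolding P_def coeff_sum using s(2) nB by (intro sum.cong refl) (auto simp: eq_diff_iff)
  also have "\<dots> = a n"
    using fin nB by simp
  finally show ?thesis by simp
qed

lemma det_block_vandermonde:
  fixes z :: "nat \<Rightarrow> complex" and \<sigma> :: "nat \<Rightarrow> nat"
  assumes mono: "mono_on {0..<N} \<sigma>" and inj: "inj_on (\<lambda>i. (\<sigma> i, z i)) {0..<N}"
    and nz: "\<And>i. i < N \<Longrightarrow> z i \<noteq> 0"
  shows "det (mat N N (\<lambda>(n, i). if \<sigma> n = \<sigma> i then z i ^ (n + r) else 0)) \<noteq> 0" (is "det ?B \<noteq> 0")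
proof
  assume "det ?B = 0"
  then have "det (transpose_mat ?B) = 0"
    by (subst det_transpose) auto
  then obtain v where v: "v \<in> carrier_vec N" "v \<noteq> 0\<^sub>v N" "transpose_mat ?B *\<^sub>v v = 0\<^sub>v N"
    using det_0_iff_vec_prod_zero[of "transpose_mat ?B" N] by auto
  have "v $ n = 0" if "n < N" for n
  proof (rule block_vandermonde_kernel[OF mono inj nz])
    fix i assume i: "i < N"
    have "0 = (transpose_mat ?B *\<^sub>v v) $ i" using v(3) i by simp
    also have "\<dots> = (\<Sum>n = 0..<N. (if \<sigma> n = \<sigma> i then z i ^ (n + r) else 0) * v $ n)"
      using i v(1) by (auto simp: scalar_prod_def intro!: sum.cong)
    also have "\<dots> = (\<Sum>n | n < N \<and> \<sigma> n = \<sigma> i. v $ n * z i ^ (n + r))"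
      by (rule sum.mono_neutral_cong_right) auto
    finally show "(\<Sum>n | n < N \<and> \<sigma> n = \<sigma> i. v $ n * z i ^ (n + r)) = 0" by simp
  qed (use that in auto)
  then show False using v(1,2) by (auto simp: vec_eq_iff)
qed

section \<open>The determinant at a generic number\<close>

text \<open>
  Here \<open>\<sigma> i\<close> and \<open>z i\<close> stand for the time shift, counted from the
  cut, and for \<open>\<omega>\<^sup>l\<close>, where \<open>(k, l)\<close> is the
  \<open>i\<close>-th point. The offset \<open>r\<close> occurs in the exponents of the nodes
  because row \<open>n\<close>, counted from the cut, is row \<open>n + r\<close> modulo
  \<open>N\<close> of the original matrix.
\<close>

lemma generic_determinant_nonzero:
  fixes z :: "nat \<Rightarrow> complex" and \<sigma> :: "nat \<Rightarrow> nat"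
  assumes N: "N > 0"
    and mono: "mono_on {0..<N} \<sigma>" and le: "\<And>n. n < N \<Longrightarrow> \<sigma> n \<le> n"
    and inj: "inj_on (\<lambda>i. (\<sigma> i, z i)) {0..<N}"
    and nz: "\<And>i. i < N \<Longrightarrow> z i \<noteq> 0"
    and zK: "\<And>i. i < N \<Longrightarrow> z i \<in> cyclotomic_subfield N"
    and \<xi>: "\<not> algebraic \<xi> \<or> N * (N - 1)\<^sup>2 < degree_over (cyclotomic_subfield N) \<xi>"
  shows "det (mat N N (\<lambda>(n, i). z i ^ (n + r) * \<xi> ^ ((n + N - \<sigma> i) mod N)\<^sup>2)) \<noteq> 0" (is "det ?A \<noteq> 0")
proof -
  let ?perms = "{p. p permutes {0..<N}}"
  define E where "E p = (\<Sum>n = 0..<N. ((n + N - \<sigma> (p n)) mod N)\<^sup>2)" for p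
  define c where "c p = signof p * (\<Prod>n = 0..<N. z (p n) ^ (n + r))" for p
  define P where "P = (\<Sum>p\<in>?perms. Polynomial.monom (c p) (E p))"
  have fin: "finite ?perms" by (simp add: finite_permutations)
  have ptw: "p n < N" if "p permutes {0..<N}" "n < N" for p n
    using permutes_in_image[OF that(1), of n] that(2) by simp
  have "det ?A = (\<Sum>p\<in>?perms. signof p * (\<Prod>n = 0..<N. z (p n) ^ (n + r) * \<xi> ^ ((n + N - \<sigma> (p n)) mod N)\<^sup>2))"
    by (simp add: det_def ptw)
  also have "\<dots> = poly P \<xi>"
    by (simp add: P_def poly_sum poly_monom c_def E_def prod.distrib power_sum mult.assoc)
  finally have det: "det ?A = poly P \<xi>" .

  \<comment> \<open>A permutation has the least exponent \<open>E id\<close> iff it preserves the blocks, which is also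
    the condition for its term in the Leibniz expansion of \<open>det ?B\<close> not to contain a zero entry.\<close>
  let ?B = "mat N N (\<lambda>(n, i). if \<sigma> n = \<sigma> i then z i ^ (n + r) else 0)"
  have summand: "signof p * (\<Prod>n = 0..<N. if \<sigma> n = \<sigma> (p n) then z (p n) ^ (n + r) else 0) =
      (if E p = E id then c p else 0)" if p: "p permutes {0..<N}" for p
  proof (cases "\<forall>n<N. \<sigma> (p n) = \<sigma> n")
    case True
    then have "E p = E id"
      using cyclic_cost(2)[OF mono le p] by (simp add: E_def)
    with True show ?thesis by (simp add: c_def)
  next
    case False
    then have "E p \<noteq> E id"
      using cyclic_cost(2)[OF mono le p] by (simp add: E_def)
    moreover obtain m where "m < N" "\<sigma> (p m) \<noteq> \<sigma> m" using False by blast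
    then have "(\<Prod>n = 0..<N. if \<sigma> n = \<sigma> (p n) then z (p n) ^ (n + r) else 0) = 0"
      by (intro prod_zero bexI[of _ m]) auto
    ultimately show ?thesis by simp
  qed
  have "det ?B = (\<Sum>p\<in>?perms. signof p * (\<Prod>n = 0..<N. if \<sigma> n = \<sigma> (p n) then z (p n) ^ (n + r) else 0))"
    by (simp add: det_def ptw)
  also have "\<dots> = (\<Sum>p\<in>?perms. if E p = E id then c p else 0)"
    using summand by (intro sum.cong) auto
  also have "\<dots> = Polynomial.coeff P (E id)"
    by (simp add: P_def coeff_sum)
  finally have "Polynomial.coeff P (E id) \<noteq> 0"
    using det_block_vandermonde[OF mono inj nz, of r] by simp
  then have "P \<noteq> 0" by auto
  moreover have "Polynomial.degree P \<le> N * (N - 1)\<^sup>2"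
  proof -
    have "E p \<le> N * (N - 1)\<^sup>2" for p
    proof -
      have "E p \<le> (\<Sum>n = 0..<N. (N - 1)\<^sup>2)"
        unfolding E_def
      proof (intro sum_mono power_mono)
        fix n
        have "(n + N - \<sigma> (p n)) mod N < N" using N by simp
        then show "(n + N - \<sigma> (p n)) mod N \<le> N - 1" by linarith
      qed simp
      then show ?thesis by simp
    qed
    then show ?thesis
      unfolding P_def by (intro degree_sum_le fin order.trans[OF degree_monom_le])
  qed
  moreover have "Polynomial.coeff P i \<in> cyclotomic_subfield N" for i
  proof -
    have prod: "prod f A \<in> cyclotomic_subfield N" if "\<And>a. a \<in> A \<Longrightarrow> f a \<in> cyclotomic_subfield N"
      for f and A :: "nat set"
      using that by (induction A rule: infinite_finite_induct) (auto intro: cyclotomic_closed)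
    have sum: "sum f A \<in> cyclotomic_subfield N" if "\<And>a. a \<in> A \<Longrightarrow> f a \<in> cyclotomic_subfield N"
      for f and A :: "(nat \<Rightarrow> nat) set"
      using that by (induction A rule: infinite_finite_induct) (auto intro: cyclotomic_closed)
    have "c p \<in> cyclotomic_subfield N" if "p permutes {0..<N}" for p
    proof -
      have "signof p \<in> cyclotomic_subfield N"
        by (cases p rule: sign_cases) (auto intro: cyclotomic_closed)
      then show ?thesis
        unfolding c_def using ptw[OF that] zK by (intro cyclotomic_closed(6,7) prod) auto
    qed
    then show ?thesis
      by (auto simp: P_def coeff_sum intro!: sum cyclotomic_closed(2))
  qed
  ultimately show ?thesis
    unfolding det using poly_nonzero_if_degree_small[OF N \<xi>] by blast
qed

section \<open>Time-frequency shifts\<close>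

lemma basis_family_if_det_nonzero:
  assumes bij: "bij_betw q {0..<N} I" and carr: "\<And>p. p \<in> I \<Longrightarrow> v p \<in> carrier_vec N"
    and det: "det (mat N N (\<lambda>(n, i). v (q i) $ n)) \<noteq> 0"
  shows "basis_family N v I"
proof -
  define A where "A = mat N N (\<lambda>(n, i). v (q i) $ n)"
  have A: "A \<in> carrier_mat N N" by (simp add: A_def)
  have col: "col A i = v (q i)" if "i < N" for i
    using that carr[of "q i"] bij_betwE[OF bij] by (intro eq_vecI) (auto simp: A_def)
  have inj: "inj_on (v \<circ> q) {0..<N}"
  proof (rule inj_onI)
    fix i j assume "i \<in> {0..<N}" "j \<in> {0..<N}" "(v \<circ> q) i = (v \<circ> q) j"
    then show "i = j"
      using det_identical_columns[OF A, of i j] det col[of i] col[of j] by (auto simp flip: A_def)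
  qed
  have img: "v ` I = set (cols A)"
    unfolding cols_def using A col bij_betw_imp_surj_on[OF bij]
    by (force simp: image_iff)
  have injv: "inj_on v I"
    using inj bij by (metis bij_betw_def comp_inj_on_iff)
  interpret VS: vec_space "TYPE(complex)" N .
  have "VS.lin_indpt (set (cols A))"
    using VS.lin_dep_cols_imp_det_0[OF A] det by (auto simp flip: A_def)
  moreover have "card (v ` I) = N"
    using card_image[OF injv] bij_betw_same_card[OF bij] by simp
  ultimately have "VS.basis (v ` I)"
    using carr finite_set[of "cols A"] unfolding img[symmetric]
    by (intro VS.dim_li_is_basis) (auto simp: VS.dim_is_n)
  with injv show ?thesis by (simp add: basis_family_def)
qed

lemma time_freq_shift_entry:
  assumes "n < N" "k < N" "x \<in> carrier_vec N"
  shows "time_freq_shift N (k, l) x $ n = (root_of_unity N ^ l) ^ n * x $ ((n + N - k) mod N)"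
proof -
  have "(n + N - k) mod N = (if n < k then n + N - k else n - k)"
  proof (cases "n < k")
    case False
    then have "(n + N - k) mod N = (n - k) mod N"
      by (metis Nat.add_diff_assoc2 mod_add_self2 not_less)
    with False assms(1) show ?thesis by simp
  qed (use assms in simp)
  then show ?thesis
    using assms by (simp add: time_freq_shift_def translation_pow modulation_pow mult.commute flip: power_mult)
qed

lemma inj_root_of_unity_power:
  assumes "l < N" "l' < N" "root_of_unity N ^ l = root_of_unity N ^ l'"
  shows "l = l'"
proof -
  have "root_of_unity N ^ m = cis (2 * pi * real m / real N)" for m
    by (simp add: root_of_unity_def cis_conv_exp mult_ac flip: exp_of_nat_mult)
  then have "inj_on (\<lambda>m. root_of_unity N ^ m) {..<N}"
    using bij_betw_roots_unity[of N] assms(1) by (simp add: bij_betw_def)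
  then show ?thesis
    using assms by (auto dest: inj_onD)
qed

text \<open>
  The arc from \<open>k\<close> to \<open>n + r\<close> does not change its length when both ends
  are counted from \<open>r\<close>.
\<close>

lemma cyclic_shift_add:
  fixes n k r :: nat
  assumes "k < N" "r < N"
  shows "((n + r) mod N + N - k) mod N = (n + N - (k + N - r) mod N) mod N"
proof -
  have "(n + r) mod N + N - k = (n + r) mod N + (N - k)"
    using assms(1) by simp
  then have *: "((n + r) mod N + N - k) mod N = (n + r + (N - k)) mod N"
    by (simp only: mod_add_left_eq)
  show ?thesis
  proof (cases "r \<le> k")
    case True
    then have "(k + N - r) mod N = (k - r) mod N"
      by (metis Nat.add_diff_assoc2 mod_add_self2)
    then have "n + N - (k + N - r) mod N = n + r + (N - k)"
      using True assms by simp
    then show ?thesis by (simp only: *)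
  next
    case False
    then have "(k + N - r) mod N = k + N - r"
      using assms by simp
    then have "n + r + (N - k) = (n + N - (k + N - r) mod N) + N"
      using False assms by simp
    then show ?thesis by (simp only: * mod_add_self2)
  qed
qed

theorem corollary5p2:
  fixes N :: nat and \<xi> :: complex
  assumes "N > 0"
    and "\<not> algebraic \<xi> \<or>
         (algebraic \<xi> \<and> degree_over (cyclotomic_subfield N) \<xi> \<ge> N * (N - 1)\<^sup>2 + 1)"
  shows "gabor_frame_general_linear_position N (vec N (\<lambda>n. \<xi> ^ (n\<^sup>2)))"
  unfolding gabor_frame_general_linear_position_def
proof (intro allI impI)
  fix \<Lambda> :: "(nat \<times> nat) set"
  assume sub: "\<Lambda> \<subseteq> {0..<N} \<times> {0..<N}" and card: "card \<Lambda> = N"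
  let ?\<phi> = "vec N (\<lambda>n. \<xi> ^ (n\<^sup>2))" and ?\<omega> = "root_of_unity N"
  have fin: "finite \<Lambda>" using sub finite_subset by blast
  have fst_less: "fst p < N" if "p \<in> \<Lambda>" for p using sub that by auto
  obtain r where r: "r < N" "\<And>j. j \<le> N \<Longrightarrow> j \<le> card {p \<in> \<Lambda>. (fst p + N - r) mod N < j}"
    using cycle_lemma[OF card assms(1), of fst] fst_less by blast
  define g where "g p = (fst p + N - r) mod N" for p :: "nat \<times> nat"
  obtain q where q: "bij_betw q {0..<N} \<Lambda>" "mono_on {0..<N} (g \<circ> q)" "\<And>i. i < N \<Longrightarrow> g (q i) \<le> i"
    using sorted_enumeration[OF fin card, of g] r(2) unfolding g_def by blast
  define z where "z i = ?\<omega> ^ snd (q i)" for i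
  have q_less: "fst (q i) < N" "snd (q i) < N" if "i < N" for i
    using bij_betwE[OF q(1)] sub that by force+
  have "?\<omega> \<noteq> 0" by (simp add: root_of_unity_def)

  \<comment> \<open>A point is determined by its time shift and its node, so within a block the nodes differ.\<close>
  have inj: "inj_on (\<lambda>i. ((g \<circ> q) i, z i)) {0..<N}"
  proof (rule inj_onI)
    fix i j assume ij: "i \<in> {0..<N}" "j \<in> {0..<N}" "((g \<circ> q) i, z i) = ((g \<circ> q) j, z j)"
    then have "snd (q i) = snd (q j)"
      using q_less by (auto simp: z_def intro: inj_root_of_unity_power)
    moreover have "fst (q i) = fst (q j)"
    proof -
      have "fst (q m) = (g (q m) + r) mod N" if "m < N" for m
      proof -
        have "(g (q m) + r) mod N = (fst (q m) + N - r + r) mod N"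
          unfolding g_def by (simp only: mod_add_left_eq)
        then show ?thesis using q_less[OF that] r(1) by simp
      qed
      then show ?thesis using ij by simp
    qed
    ultimately have "q i = q j"
      by (simp add: prod_eq_iff)
    then show "i = j"
      using q(1) ij(1,2) unfolding bij_betw_def by (blast dest: inj_onD)
  qed
  have zK: "z i \<in> cyclotomic_subfield N" for i
    unfolding z_def by (intro cyclotomic_closed)
  let ?A = "mat N N (\<lambda>(n, i). z i ^ (n + r) * \<xi> ^ ((n + N - (g \<circ> q) i) mod N)\<^sup>2)"
  have detA: "det ?A \<noteq> 0"
    using q(3) \<open>?\<omega> \<noteq> 0\<close> assms(2)
    by (intro generic_determinant_nonzero[OF assms(1) q(2) _ inj _ zK]) (auto simp: z_def)

  let ?V = "mat N N (\<lambda>(n, i). time_freq_shift N (q i) ?\<phi> $ n)"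
  have z_period: "z i ^ (m mod N) = z i ^ m" for i m
  proof -
    have "z i ^ N = 1"
      using root_of_unity_pow_N[OF assms(1)] by (metis z_def mult.commute power_mult power_one)
    then have "z i ^ m = z i ^ (m mod N + N * (m div N))" by simp
    also have "\<dots> = z i ^ (m mod N)"
      using \<open>z i ^ N = 1\<close> by (simp only: power_add power_mult power_one mult_1_right)
    finally show ?thesis by simp
  qed
  have entry: "?V $$ ((n + r) mod N, i) = ?A $$ (n, i)" if "n < N" "i < N" for n i
  proof -
    obtain k l where kl: "q i = (k, l)" by force
    have kN: "k < N" using q_less[OF that(2)] kl by simp
    have rowN: "(n + r) mod N < N" using assms(1) by simp
    have "?V $$ ((n + r) mod N, i) = z i ^ ((n + r) mod N) * \<xi> ^ (((n + r) mod N + N - k) mod N)\<^sup>2"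
      using rowN kN that assms(1) by (simp add: kl time_freq_shift_entry z_def)
    also have "\<dots> = z i ^ (n + r) * \<xi> ^ ((n + N - (k + N - r) mod N) mod N)\<^sup>2"
      by (simp only: z_period cyclic_shift_add[OF kN r(1)])
    finally show ?thesis using that by (simp add: g_def kl)
  qed
  \<comment> \<open>The rows of \<open>?A\<close> are those of \<open>?V\<close>, cyclically rotated, so both have the same kernel.\<close>
  have "det ?V \<noteq> 0"
  proof
    assume "det ?V = 0"
    then obtain v where v: "v \<in> carrier_vec N" "v \<noteq> 0\<^sub>v N" "?V *\<^sub>v v = 0\<^sub>v N"
      using det_0_iff_vec_prod_zero[of ?V N] by auto
    have "?A *\<^sub>v v = 0\<^sub>v N"
    proof (rule eq_vecI)
      fix n assume "n < dim_vec (0\<^sub>v N :: complex vec)"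
      then have n: "n < N" by simp
      have rowN: "(n + r) mod N < N" using assms(1) by simp
      have "(?A *\<^sub>v v) $ n = (\<Sum>i = 0..<N. ?A $$ (n, i) * v $ i)"
        using n v(1) by (auto simp: scalar_prod_def intro!: sum.cong)
      also have "\<dots> = (\<Sum>i = 0..<N. ?V $$ ((n + r) mod N, i) * v $ i)"
        using entry[OF n] by (intro sum.cong) auto
      also have "\<dots> = (?V *\<^sub>v v) $ ((n + r) mod N)"
        using rowN v(1) by (auto simp: scalar_prod_def intro!: sum.cong)
      finally show "(?A *\<^sub>v v) $ n = 0\<^sub>v N $ n"
        using v(3) n rowN by simp
    qed simp
    then show False
      using det_0_iff_vec_prod_zero[of ?A N] detA v(1,2) by auto
  qed
  moreover have "time_freq_shift N p ?\<phi> \<in> carrier_vec N" if "p \<in> \<Lambda>" for p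
  proof -
    obtain k l where p: "p = (k, l)" by force
    then have "k < N" using fst_less[OF that] by simp
    then show ?thesis
      by (simp add: p time_freq_shift_def translation_pow modulation_pow)
  qed
  ultimately show "basis_family N (\<lambda>p. time_freq_shift N p ?\<phi>) \<Lambda>"
    using q(1) by (intro basis_family_if_det_nonzero) auto
qed

end
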